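(* Let $H$ be a contextuality scenario. A probabilistic model $p\in\mathcal{G}(H)$ is in $\mathcal{Q}_1(H)$ if and only if $\vartheta(\mathrm{NO}(H),p)=1$.
   Context: A contextuality scenario is a hypergraph $H$ with finite nonempty vertex set $V(H)$ and edge set $E(H)\subseteq 2^{V(H)}$ such that $\bigcup_{e\in E(H)}e=V(H)$. A probabilistic model on $H$ is a map $p:V(H)\to[0,1]$ with $\sum_{v\in e}p(v)=1$ for all $e\in E(H)$; $\mathcal{G}(H)$ is the set of these. For $u,v\in V(H)$ write $u\perp v$ if $u\neq v$ and some edge contains both. The non-orthogonality graph $\mathrm{NO}(H)$ is the simple graph on $V(H)$ in which distinct $u,v$ are adjacent iff $u\not\perp v$. $\mathcal{Q}_1(H)$ is the set of $p:V(H)\to[0,1]$ for which there is a positive semidefinite complex matrix $M$ with rows and columns indexed by $V(H)\cup\{\emptyset\}$ ($\emptyset$ being an extra index symbol) such that $M_{\emptyset,\emptyset}=1$; $\sum_{x\in e}M_{x,w}=M_{\emptyset,w}$ for all $e\in E(H)$ and all $w\in V(H)\cup\{\emptyset\}$; $M_{u,v}=0$ whenever $u\perp v$; and $p(v)=M_{v,\emptyset}$ for all $v\in V(H)$. For a graph $G$ with weights $p:V(G)\to\mathbb{R}_{\geq0}$, the weighted Lovász number is $\vartheta(G,p)=\min_{|\Psi\rangle,|\psi_v\rangle}\max_{v\in V(G)}\frac{p(v)}{|\langle\Psi|\psi_v\rangle|^2}$ (convention $\frac00=0$), where $|\Psi\rangle\in\mathbb{R}^{|V(G)|}$ ranges over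 unit vectors and $(|\psi_v\rangle)_{v}$ over orthonormal labelings of $G$, i.e. families of unit vectors $|\psi_v\rangle\in\mathbb{R}^{|V(G)|}$ with $\langle\psi_u|\psi_v\rangle=0$ for all distinct non-adjacent $u,v$. *)

theory Defs
  imports
    Complex_Main
    "HOL-Library.FuncSet"
    "HOL-Library.Extended_Real"
    "Jordan_Normal_Form.Matrix"
    "Graph_Theory.Pair_Digraph"
begin

section \<open>Contextuality scenarios and probabilistic models\<close>

record 'v hypergraph =
  vertices :: "'v set"
  edges :: "'v set set"

definition contextuality_scenario :: "'v hypergraph \<Rightarrow> bool" where
  "contextuality_scenario H \<longleftrightarrow>
     finite (vertices H) \<and> vertices H \<noteq> {} \<and>
     edges H \<subseteq> Pow (vertices H) \<and> \<Union>(edges H) = vertices H"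

text \<open>Maps on the vertex set are total functions whose values outside the vertex set are
  never inspected.\<close>

definition prob_models :: "'v hypergraph \<Rightarrow> ('v \<Rightarrow> real) set" where
  "prob_models H =
     {p. p \<in> vertices H \<rightarrow> {0..1} \<and> (\<forall>e\<in>edges H. (\<Sum>v\<in>e. p v) = 1)}"

definition orthogonal :: "'v hypergraph \<Rightarrow> 'v \<Rightarrow> 'v \<Rightarrow> bool" where
  "orthogonal H u v \<longleftrightarrow> u \<noteq> v \<and> (\<exists>e\<in>edges H. u \<in> e \<and> v \<in> e)"

text \<open>A simple graph is a digraph with symmetric and irreflexive arc relation.\<close>

definition non_orthogonality_graph :: "'v hypergraph \<Rightarrow> 'v pair_pre_digraph" where
  "non_orthogonality_graph H =
     \<lparr>pverts = vertices H,
      parcs = {(u, v). u \<in> vertices H \<and> v \<in> vertices H \<and> u \<noteq> v \<and> \<not> orthogonal H u v}\<rparr>"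

lemma pair_graph_non_orthogonality_graph:
  assumes "contextuality_scenario H"
  shows "pair_graph (non_orthogonality_graph H)"
proof -
  let ?G = "non_orthogonality_graph H"
  have fin: "finite (pverts ?G)"
    using assms by (simp add: contextuality_scenario_def non_orthogonality_graph_def)
  have sub: "parcs ?G \<subseteq> pverts ?G \<times> pverts ?G"
    by (auto simp: non_orthogonality_graph_def)
  have sym_arcs: "sym (parcs ?G)"
    by (auto simp: non_orthogonality_graph_def orthogonal_def intro!: symI)
  have "pair_fin_digraph ?G"
    using fin sub finite_subset[OF sub] by unfold_locales auto
  moreover have "pair_loopfree_digraph ?G"
    using sub by unfold_locales (auto simp: non_orthogonality_graph_def)
  moreover have "pair_sym_digraph ?G"
    using sub sym_arcs by unfold_locales (auto simp: symmetric_def)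
  ultimately show ?thesis
    by (simp add: pair_graph_def pair_digraph_def pair_pseudo_graph_def)
qed


section \<open>The set \<open>\<Q>\<^sub>1\<close>\<close>

text \<open>For complex matrices the condition that the quadratic form is real and nonnegative
  already entails that the matrix is Hermitian.\<close>

definition psd_on :: "'i set \<Rightarrow> ('i \<Rightarrow> 'i \<Rightarrow> complex) \<Rightarrow> bool" where
  "psd_on I M \<longleftrightarrow>
     (\<forall>x :: 'i \<Rightarrow> complex.
        (\<Sum>i\<in>I. \<Sum>j\<in>I. cnj (x i) * M i j * x j) \<in> \<real> \<and>
        0 \<le> Re (\<Sum>i\<in>I. \<Sum>j\<in>I. cnj (x i) * M i j * x j))"

text \<open>The extra index symbol is \<^term>\<open>None\<close>; a vertex \<open>v\<close> is the index \<^term>\<open>Some v\<close>.\<close>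

definition Q1_indices :: "'v hypergraph \<Rightarrow> 'v option set" where
  "Q1_indices H = insert None (Some ` vertices H)"

definition Q1 :: "'v hypergraph \<Rightarrow> ('v \<Rightarrow> real) set" where
  "Q1 H =
     {p. p \<in> vertices H \<rightarrow> {0..1} \<and>
        (\<exists>M :: 'v option \<Rightarrow> 'v option \<Rightarrow> complex.
           psd_on (Q1_indices H) M \<and>
           M None None = 1 \<and>
           (\<forall>e\<in>edges H. \<forall>w\<in>Q1_indices H. (\<Sum>x\<in>e. M (Some x) w) = M None w) \<and>
           (\<forall>u v. orthogonal H u v \<longrightarrow> M (Some u) (Some v) = 0) \<and>
           (\<forall>v\<in>vertices H. complex_of_real (p v) = M (Some v) None))}"


section \<open>The weighted Lovasz number\<close>

definition unit_vectors :: "nat \<Rightarrow> real vec set" where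
  "unit_vectors n = {u \<in> carrier_vec n. scalar_prod u u = 1}"

definition orthonormal_labelings :: "'v pair_pre_digraph \<Rightarrow> ('v \<Rightarrow> real vec) set" where
  "orthonormal_labelings G =
     {\<psi>. \<psi> \<in> pverts G \<rightarrow> unit_vectors (card (pverts G)) \<and>
         (\<forall>u\<in>pverts G. \<forall>v\<in>pverts G.
            u \<noteq> v \<longrightarrow> (u, v) \<notin> parcs G \<longrightarrow> scalar_prod (\<psi> u) (\<psi> v) = 0)}"

text \<open>Division in \<^typ>\<open>ereal\<close> satisfies \<open>0 / 0 = 0\<close> and \<open>a / 0 = \<infinity>\<close> for \<open>a > 0\<close>, which is
  the convention needed here. (Real division would wrongly give \<open>a / 0 = 0\<close>.)\<close>

lemma ereal_zero_divide_zero: "ereal 0 / ereal 0 = 0"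
  by (simp add: ereal_divide)

lemma ereal_pos_divide_zero: "0 < a \<Longrightarrow> ereal a / ereal 0 = \<infinity>"
  by (simp add: ereal_divide)

definition labeling_value ::
  "'v pair_pre_digraph \<Rightarrow> ('v \<Rightarrow> real) \<Rightarrow> real vec \<Rightarrow> ('v \<Rightarrow> real vec) \<Rightarrow> ereal" where
  "labeling_value G p \<Psi> \<psi> =
     Max ((\<lambda>v. ereal (p v) / ereal (\<bar>scalar_prod \<Psi> (\<psi> v)\<bar>\<^sup>2)) ` pverts G)"

text \<open>\<open>LEAST\<close> denotes a minimum that is attained, rather than an infimum.\<close>

definition weighted_lovasz :: "'v pair_pre_digraph \<Rightarrow> ('v \<Rightarrow> real) \<Rightarrow> ereal" where
  "weighted_lovasz G p =
     (LEAST t. \<exists>\<Psi>\<in>unit_vectors (card (pverts G)). \<exists>\<psi>\<in>orthonormal_labelings G.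
        t = labeling_value G p \<Psi> \<psi>)"

end

theory Submission
  imports Defs
begin

text \<open>
  The vectors of an orthonormal labeling that belong to one edge are pairwise orthogonal, so by
  Bessel's inequality the squared overlaps with the handle sum to at most \<open>1\<close> on every edge.
  As \<open>p\<close> sums to \<open>1\<close> on an edge, the weighted Lovasz number is at least \<open>1\<close>, and a labeling of
  value \<open>1\<close> has all squared overlaps equal to \<open>p\<close> and expands the handle on every edge. The Gram
  matrix of the handle and of its projections onto the labeling vectors then witnesses
  membership in \<open>\<Q>\<^sub>1\<close>. Conversely, the real part of a witness for \<open>\<Q>\<^sub>1\<close>, restricted to the support
  of \<open>p\<close>, is a Gram matrix of vectors with coordinates in that support; normalising them, and
  giving each vertex outside the support its own coordinate vector, yields a labeling of value
  \<open>1\<close>. That the minimum is attained follows from compactness.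
\<close>

section \<open>Gram matrices\<close>

lemma sum_sum_insert:
  fixes f :: "'i \<Rightarrow> 'i \<Rightarrow> 'b::comm_monoid_add"
  assumes "finite I" "a \<notin> I"
  shows "(\<Sum>i\<in>insert a I. \<Sum>j\<in>insert a I. f i j) =
    f a a + (\<Sum>j\<in>I. f a j) + (\<Sum>i\<in>I. f i a) + (\<Sum>i\<in>I. \<Sum>j\<in>I. f i j)"
proof -
  have "(\<Sum>i\<in>I. \<Sum>j\<in>insert a I. f i j) = (\<Sum>i\<in>I. f i a) + (\<Sum>i\<in>I. \<Sum>j\<in>I. f i j)"
    using assms by (simp add: sum.distrib)
  then show ?thesis using assms by (simp add: add.assoc)
qed

lemma sum_sum_supported:
  fixes f :: "'i \<Rightarrow> 'i \<Rightarrow> 'b::comm_monoid_add"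
  assumes "finite I" "J \<subseteq> I" "\<And>i j. i \<notin> J \<or> j \<notin> J \<Longrightarrow> f i j = 0"
  shows "(\<Sum>i\<in>I. \<Sum>j\<in>I. f i j) = (\<Sum>i\<in>J. \<Sum>j\<in>J. f i j)"
proof -
  have "(\<Sum>i\<in>I. \<Sum>j\<in>I. f i j) = (\<Sum>i\<in>I. \<Sum>j\<in>J. f i j)"
    using assms by (intro sum.cong refl sum.mono_neutral_right) auto
  also have "\<dots> = (\<Sum>i\<in>J. \<Sum>j\<in>J. f i j)"
    using assms by (intro sum.mono_neutral_right) auto
  finally show ?thesis .
qed

text \<open>Symmetry is a separate clause because a quadratic form on real vectors sees only the
  symmetric part of its matrix.\<close>

definition real_psd_on :: "'i set \<Rightarrow> ('i \<Rightarrow> 'i \<Rightarrow> real) \<Rightarrow> bool" where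
  "real_psd_on I M \<longleftrightarrow>
     (\<forall>i\<in>I. \<forall>j\<in>I. M i j = M j i) \<and> (\<forall>x. 0 \<le> (\<Sum>i\<in>I. \<Sum>j\<in>I. x i * M i j * x j))"

text \<open>A test vector on \<open>J\<close> extends by zero to one on \<open>I\<close> without
  changing the value of the form.\<close>

lemma real_psd_on_subset:
  assumes "real_psd_on I M" "finite I" "J \<subseteq> I"
  shows "real_psd_on J M"
  unfolding real_psd_on_def
proof (intro conjI allI)
  show "\<forall>i\<in>J. \<forall>j\<in>J. M i j = M j i"
    using assms by (auto simp: real_psd_on_def)
  fix x :: "'a \<Rightarrow> real"
  define y where "y i = (if i \<in> J then x i else 0)" for i
  have "0 \<le> (\<Sum>i\<in>I. \<Sum>j\<in>I. y i * M i j * y j)"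
    using assms(1) by (simp add: real_psd_on_def)
  also have "\<dots> = (\<Sum>i\<in>J. \<Sum>j\<in>J. y i * M i j * y j)"
    using assms by (intro sum_sum_supported) (auto simp: y_def)
  also have "\<dots> = (\<Sum>i\<in>J. \<Sum>j\<in>J. x i * M i j * x j)"
    by (intro sum.cong) (auto simp: y_def)
  finally show "0 \<le> (\<Sum>i\<in>J. \<Sum>j\<in>J. x i * M i j * x j)" .
qed

lemma real_psd_on_diag_nonneg:
  assumes "real_psd_on I M" "finite I" "a \<in> I"
  shows "0 \<le> M a a"
proof -
  have "real_psd_on {a} M"
    using assms real_psd_on_subset by blast
  then have "0 \<le> (\<Sum>i\<in>{a}. \<Sum>j\<in>{a}. 1 * M i j * 1)"
    unfolding real_psd_on_def by (elim conjE allE[of _ "\<lambda>_. 1"])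
  then show ?thesis by simp
qed

text \<open>With a zero diagonal entry at \<open>a\<close>, the form on the two indices is affine in
  the coordinate at \<open>a\<close>, with slope \<open>2 * M a b\<close>; a nonzero slope would
  make it negative somewhere.\<close>

lemma real_psd_on_zero_diag:
  assumes "real_psd_on I M" "finite I" "a \<in> I" "b \<in> I" "M a a = 0"
  shows "M a b = 0"
proof (cases "a = b")
  case False
  \<comment> \<open>This \<open>t\<close> is chosen so that the form takes the value -1 whenever
    \<open>M a b\<close> is nonzero.\<close>
  define t where "t = - (M b b + 1) / (2 * M a b)"
  have psd: "real_psd_on {a, b} M"
    using assms real_psd_on_subset[of I M "{a, b}"] by blast
  have sym: "M b a = M a b" using psd unfolding real_psd_on_def by blast
  have "0 \<le> (\<Sum>i\<in>{a, b}. \<Sum>j\<in>{a, b}. (if i = a then t else 1) * M i j * (if j = a then t else 1))"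
    using psd unfolding real_psd_on_def by (elim conjE allE[of _ "\<lambda>i. if i = a then t else 1"])
  then have "0 \<le> 2 * (t * M a b) + M b b"
    using False assms(5) sym by (simp add: mult.commute)
  then show ?thesis
    by (cases "M a b = 0") (simp_all add: t_def field_simps)
qed (use assms in simp)

text \<open>Cholesky decomposition by taking Schur complements; if the pivot \<open>M a a\<close> vanishes, so does
  its row, and division by zero gives the right value \<open>0\<close>.\<close>

lemma real_psd_on_gram:
  assumes "finite I" "real_psd_on I M"
  shows "\<exists>A. \<forall>i\<in>I. \<forall>j\<in>I. M i j = (\<Sum>k\<in>I. A i k * A j k :: real)"
  using assms
proof (induction I arbitrary: M rule: finite_induct)
  case (insert a I)
  define N where "N i j = M i j - M i a * M a j / M a a" for i j
  have sym: "M i j = M j i" if "i \<in> insert a I" "j \<in> insert a I" for i j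
    using insert.prems that unfolding real_psd_on_def by blast
  have nonneg: "0 \<le> M a a"
    using real_psd_on_diag_nonneg[OF insert.prems] insert.hyps by simp
  have zero: "M a i = 0" if "M a a = 0" "i \<in> insert a I" for i
    using real_psd_on_zero_diag[OF insert.prems, of a i] insert.hyps that by simp
  have "real_psd_on I N"
    unfolding real_psd_on_def
  proof (intro conjI allI ballI)
    show "N i j = N j i" if "i \<in> I" "j \<in> I" for i j
      using that sym[of i j] sym[of i a] sym[of j a] by (simp add: N_def mult.commute)
    fix x :: "'a \<Rightarrow> real"
    define s where "s = (\<Sum>i\<in>I. M a i * x i)"
    \<comment> \<open>Completing the square: this coordinate at the pivot minimises the form of
      \<open>M\<close>, and the minimum is the form of \<open>N\<close> at \<open>x\<close>.\<close>
    define y where "y = x(a := - s / M a a)"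
    have s0: "s = 0" if "M a a = 0"
      unfolding s_def using zero[OF that] by (intro sum.neutral) auto
    have y: "y i = x i" if "i \<in> I" for i
      using that insert.hyps by (auto simp: y_def)
    have ya: "y a = - s / M a a" by (simp add: y_def)
    have row: "(\<Sum>j\<in>I. y a * M a j * y j) = y a * s"
      unfolding s_def sum_distrib_left by (intro sum.cong) (auto simp: y)
    have col: "(\<Sum>i\<in>I. y i * M i a * y a) = y a * s"
      unfolding s_def sum_distrib_left
      by (intro sum.cong refl) (simp add: y sym[of _ a])
    have ss: "s * s = (\<Sum>i\<in>I. \<Sum>j\<in>I. x i * M i a * (M a j * x j))"
      unfolding s_def sum_product by (intro sum.cong refl) (simp add: sym[of _ a] mult.commute)
    have "(\<Sum>i\<in>I. \<Sum>j\<in>I. x i * N i j * x j) =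
        (\<Sum>i\<in>I. \<Sum>j\<in>I. x i * M i j * x j - x i * M i a * (M a j * x j) / M a a)"
      by (intro sum.cong refl) (simp add: N_def algebra_simps)
    also have "\<dots> = (\<Sum>i\<in>I. \<Sum>j\<in>I. x i * M i j * x j) - s * s / M a a"
      unfolding ss by (simp add: sum_subtractf sum_divide_distrib)
    \<comment> \<open>The diagonal term is \<open>s * s / M a a\<close> and the two cross terms
      together are minus twice that. For a zero pivot all of them are 0.\<close>
    also have "\<dots> = y a * M a a * y a + y a * s + y a * s + (\<Sum>i\<in>I. \<Sum>j\<in>I. x i * M i j * x j)"
      using s0 unfolding ya by (cases "M a a = 0") (auto simp: field_simps)
    also have "(\<Sum>i\<in>I. \<Sum>j\<in>I. x i * M i j * x j) = (\<Sum>i\<in>I. \<Sum>j\<in>I. y i * M i j * y j)"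
      by (intro sum.cong refl) (simp add: y)
    also have "y a * M a a * y a + y a * s + y a * s + \<dots> =
        (\<Sum>i\<in>insert a I. \<Sum>j\<in>insert a I. y i * M i j * y j)"
      using row col by (subst sum_sum_insert[OF insert.hyps]) simp
    also have "\<dots> \<ge> 0" using insert.prems by (simp add: real_psd_on_def)
    finally show "0 \<le> (\<Sum>i\<in>I. \<Sum>j\<in>I. x i * N i j * x j)" .
  qed
  from insert.IH[OF this] obtain A where
    A: "\<And>i j. i \<in> I \<Longrightarrow> j \<in> I \<Longrightarrow> N i j = (\<Sum>k\<in>I. A i k * A j k)" by blast
  \<comment> \<open>One new column, the pivot column divided by the root of the pivot, is added to
    the factor \<open>A\<close> of the Schur complement; row \<open>a\<close> is zero in all other
    columns.\<close>
  define B where "B i k = (if k = a then M i a / sqrt (M a a) else if i = a then 0 else A i k)"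
    for i k
  have "M i j = (\<Sum>k\<in>insert a I. B i k * B j k)" if ij: "i \<in> insert a I" "j \<in> insert a I" for i j
  proof -
    have sq: "sqrt (M a a) * sqrt (M a a) = M a a" using nonneg by simp
    have "(\<Sum>k\<in>insert a I. B i k * B j k) =
        M i a * M a j / M a a + (\<Sum>k\<in>I. B i k * B j k)"
      using insert.hyps sym[OF ij(2), of a] by (simp add: B_def sq nonneg)
    also have "(\<Sum>k\<in>I. B i k * B j k) = M i j - M i a * M a j / M a a"
    \<comment> \<open>In row and column \<open>a\<close> the Schur complement vanishes: by
      cancellation if the pivot is positive, and because that row of \<open>M\<close> is zero
      otherwise.\<close>
    proof (cases "i = a \<or> j = a")
      case True
      then have "(\<Sum>k\<in>I. B i k * B j k) = 0"
        using insert.hyps by (intro sum.neutral) (auto simp: B_def)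
      moreover have "M i j = M i a * M a j / M a a"
        using True zero ij sym[OF ij(1), of a] by (cases "M a a = 0") auto
      ultimately show ?thesis by simp
    next
      case False
      then have "(\<Sum>k\<in>I. B i k * B j k) = (\<Sum>k\<in>I. A i k * A j k)"
        using insert.hyps by (intro sum.cong refl) (auto simp: B_def)
      also have "\<dots> = N i j" using False ij by (subst A) auto
      finally show ?thesis by (simp add: N_def)
    qed
    finally show ?thesis by simp
  qed
  then show ?case by blast
qed simp

section \<open>Complex positive semidefinite forms\<close>

lemma psd_on_two_point:
  assumes psd: "psd_on I M" and "finite I" "i \<in> I" "j \<in> I" "i \<noteq> j"
  shows "M i i + c * M i j + cnj c * M j i + cnj c * c * M j j \<in> \<real>"
proof -
  \<comment> \<open>The test vector is the unit vector at \<open>i\<close> plus \<open>c\<close>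
    times the unit vector at \<open>j\<close>.\<close>
  define x where "x k = (if k = i then 1 else if k = j then c else 0)" for k
  have "(\<Sum>k\<in>I. \<Sum>l\<in>I. cnj (x k) * M k l * x l) \<in> \<real>"
    using psd by (simp add: psd_on_def)
  also have "(\<Sum>k\<in>I. \<Sum>l\<in>I. cnj (x k) * M k l * x l) =
      (\<Sum>k\<in>{i, j}. \<Sum>l\<in>{i, j}. cnj (x k) * M k l * x l)"
    using assms by (intro sum_sum_supported) (auto simp: x_def)
  also have "\<dots> = M i i + c * M i j + cnj c * M j i + cnj c * c * M j j"
    using \<open>i \<noteq> j\<close> by (simp add: x_def algebra_simps)
  finally show ?thesis .
qed

text \<open>At a real vector the real part of the form involves only the real parts of the entries;
  their symmetry is part of hermiticity, recovered from the form being real.\<close>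

lemma psd_on_imp_real_psd_on_Re:
  assumes psd: "psd_on I M" and fin: "finite I"
  shows "real_psd_on I (\<lambda>i j. Re (M i j))"
  unfolding real_psd_on_def
proof (intro conjI allI ballI)
  fix i j assume ij: "i \<in> I" "j \<in> I"
  show "Re (M i j) = Re (M j i)"
  proof (cases "i = j")
    case False
    note * = psd_on_two_point[OF psd fin ij False]
    \<comment> \<open>For \<open>c = \<i>\<close> the imaginary part of the form is
      \<open>Re (M i j) - Re (M j i)\<close> plus the imaginary parts of the two diagonal entries.
      Adding the cases 1 and -1 shows that the latter cancel.\<close>
    show ?thesis
      using *[of \<i>] *[of 0] *[of 1] *[of "-1"] by (auto simp: complex_is_Real_iff)
  qed simp
next
  fix x :: "'a \<Rightarrow> real"
  have "0 \<le> Re (\<Sum>i\<in>I. \<Sum>j\<in>I. cnj (of_real (x i)) * M i j * of_real (x j))"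
    using psd unfolding psd_on_def by (elim allE[of _ "\<lambda>i. of_real (x i)"] conjE)
  then show "0 \<le> (\<Sum>i\<in>I. \<Sum>j\<in>I. x i * Re (M i j) * x j)"
    by simp
qed

text \<open>The form is a sum of squared moduli, one for each coordinate \<open>k\<close> of the
  linear combination of the vectors \<open>\<phi> j\<close> with coefficients
  \<open>x j\<close>.\<close>

lemma psd_on_gram:
  fixes \<phi> :: "'i \<Rightarrow> 'k \<Rightarrow> real"
  shows "psd_on I (\<lambda>i j. of_real (\<Sum>k\<in>K. \<phi> i k * \<phi> j k))"
  unfolding psd_on_def
proof (intro allI)
  fix x :: "'i \<Rightarrow> complex"
  define z where "z k = (\<Sum>j\<in>I. of_real (\<phi> j k) * x j)" for k
  have "(\<Sum>i\<in>I. \<Sum>j\<in>I. cnj (x i) * of_real (\<Sum>k\<in>K. \<phi> i k * \<phi> j k) * x j) =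
      (\<Sum>i\<in>I. \<Sum>j\<in>I. \<Sum>k\<in>K. cnj (of_real (\<phi> i k) * x i) * (of_real (\<phi> j k) * x j))"
    by (simp add: sum_distrib_left sum_distrib_right algebra_simps)
  also have "\<dots> = (\<Sum>i\<in>I. \<Sum>k\<in>K. \<Sum>j\<in>I. cnj (of_real (\<phi> i k) * x i) * (of_real (\<phi> j k) * x j))"
    by (intro sum.cong refl sum.swap)
  also have "\<dots> = (\<Sum>k\<in>K. \<Sum>i\<in>I. \<Sum>j\<in>I. cnj (of_real (\<phi> i k) * x i) * (of_real (\<phi> j k) * x j))"
    by (rule sum.swap)
  also have "\<dots> = (\<Sum>k\<in>K. cnj (z k) * z k)"
    by (simp only: z_def cnj_sum sum_product)
  also have "\<dots> = of_real (\<Sum>k\<in>K. (cmod (z k))\<^sup>2)"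
    by (simp only: of_real_sum complex_norm_square mult.commute)
  finally show "(\<Sum>i\<in>I. \<Sum>j\<in>I. cnj (x i) * of_real (\<Sum>k\<in>K. \<phi> i k * \<phi> j k) * x j) \<in> \<real> \<and>
      0 \<le> Re (\<Sum>i\<in>I. \<Sum>j\<in>I. cnj (x i) * of_real (\<Sum>k\<in>K. \<phi> i k * \<phi> j k) * x j)"
    by (simp add: sum_nonneg)
qed


section \<open>Attainment of the weighted Lovasz number\<close>

text \<open>Subsequences are refined one index at a time: a bounded sequence has a convergent
  monotone subsequence, and refining keeps the convergence already achieved.\<close>

lemma finite_family_bolzano_weierstrass:
  fixes c :: "nat \<Rightarrow> 'i \<Rightarrow> real"
  assumes "finite I" "\<And>k i. i \<in> I \<Longrightarrow> \<bar>c k i\<bar> \<le> B"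
  shows "\<exists>\<sigma>. strict_mono (\<sigma> :: nat \<Rightarrow> nat) \<and> (\<forall>i\<in>I. convergent (\<lambda>k. c (\<sigma> k) i))"
  using assms
proof (induction I rule: finite_induct)
  case empty
  show ?case using strict_mono_id by auto
next
  case (insert a I)
  then obtain \<sigma> :: "nat \<Rightarrow> nat" where
    \<sigma>: "strict_mono \<sigma>" "\<And>i. i \<in> I \<Longrightarrow> convergent (\<lambda>k. c (\<sigma> k) i)" by auto
  obtain \<tau> :: "nat \<Rightarrow> nat" where \<tau>: "strict_mono \<tau>" "monoseq (\<lambda>k. c (\<sigma> (\<tau> k)) a)"
    using seq_monosub[of "\<lambda>k. c (\<sigma> k) a"] by auto
  have "Bseq (\<lambda>k. c (\<sigma> (\<tau> k)) a)"
    using insert.prems by (intro BseqI'[of _ B]) auto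
  then have "convergent (\<lambda>k. c (\<sigma> (\<tau> k)) a)"
    using \<tau>(2) by (rule Bseq_monoseq_convergent)
  moreover have "convergent (\<lambda>k. c (\<sigma> (\<tau> k)) i)" if "i \<in> I" for i
    using convergent_subseq_convergent[OF \<sigma>(2)[OF that] \<tau>(1)] by (simp add: o_def)
  moreover have "strict_mono (\<sigma> \<circ> \<tau>)"
    using \<sigma>(1) \<tau>(1) by (rule strict_mono_o)
  ultimately show ?case
    by (intro exI[of _ "\<sigma> \<circ> \<tau>"]) (auto simp: strict_mono_def)
qed

text \<open>Clearing denominators absorbs the quotients 0 and \<infinity> at zero overlap and leaves
  inequalities that are polynomial in the coordinates, hence stable under limits.\<close>

lemma labeling_value_le_iff:
  assumes "finite (pverts G)" "pverts G \<noteq> {}" "\<And>v. v \<in> pverts G \<Longrightarrow> 0 \<le> p v" "0 \<le> t"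
  shows "labeling_value G p \<Psi> \<psi> \<le> ereal t \<longleftrightarrow>
    (\<forall>v\<in>pverts G. p v \<le> t * (scalar_prod \<Psi> (\<psi> v))\<^sup>2)"
proof -
  have "ereal (p v) / ereal (\<bar>s\<bar>\<^sup>2) \<le> ereal t \<longleftrightarrow> p v \<le> t * s\<^sup>2" if "v \<in> pverts G" for v s
    using assms(3)[OF that] assms(4)
    by (cases "s = 0"; cases "p v = 0") (auto simp: ereal_divide divide_le_eq)
  moreover have "labeling_value G p \<Psi> \<psi> \<le> ereal t \<longleftrightarrow>
      (\<forall>v\<in>pverts G. ereal (p v) / ereal (\<bar>scalar_prod \<Psi> (\<psi> v)\<bar>\<^sup>2) \<le> ereal t)"
    unfolding labeling_value_def using assms(1,2) by (subst Max_le_iff) blast+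
  ultimately show ?thesis by blast
qed

lemma labeling_value_nonneg:
  assumes "finite (pverts G)" "pverts G \<noteq> {}" "\<And>v. v \<in> pverts G \<Longrightarrow> 0 \<le> p v"
  shows "0 \<le> labeling_value G p \<Psi> \<psi>"
proof -
  obtain v where v: "v \<in> pverts G" using assms(2) by auto
  have "0 \<le> ereal (p v) / ereal (\<bar>scalar_prod \<Psi> (\<psi> v)\<bar>\<^sup>2)"
    using assms(3)[OF v] by (auto simp: ereal_divide)
  also have "\<dots> \<le> labeling_value G p \<Psi> \<psi>"
    unfolding labeling_value_def using v assms(1) by (intro Max_ge) auto
  finally show ?thesis .
qed

section \<open>Orthonormal labelings in coordinates\<close>

lemma orthonormal_labelings_unit:
  "\<psi> \<in> orthonormal_labelings G \<Longrightarrow> v \<in> pverts G \<Longrightarrow> \<psi> v \<in> unit_vectors (card (pverts G))"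
  by (auto simp: orthonormal_labelings_def)

lemma orthonormal_labelings_orthogonal:
  "\<psi> \<in> orthonormal_labelings G \<Longrightarrow> u \<in> pverts G \<Longrightarrow> v \<in> pverts G \<Longrightarrow> u \<noteq> v \<Longrightarrow>
    (u, v) \<notin> parcs G \<Longrightarrow> scalar_prod (\<psi> u) (\<psi> v) = 0"
  by (simp add: orthonormal_labelings_def)

lemma scalar_prod_unit_vectors:
  "v \<in> unit_vectors n \<Longrightarrow> scalar_prod u v = (\<Sum>k = 0..<n. u $ k * v $ k)"
  by (auto simp: unit_vectors_def scalar_prod_def)

lemma unit_vectors_abs_le_1:
  assumes "u \<in> unit_vectors n" "i < n"
  shows "\<bar>u $ i\<bar> \<le> 1"
proof -
  have "u $ i * u $ i \<le> (\<Sum>i = 0..<n. u $ i * u $ i)"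
    using assms(2) by (intro member_le_sum) auto
  also have "\<dots> = 1" using assms(1) by (auto simp: unit_vectors_def scalar_prod_def)
  finally show ?thesis by (simp add: abs_square_le_1[symmetric] power2_eq_square)
qed

text \<open>An enumeration of \<open>V\<close> lets vectors be built with vertices as coordinates,
  in exactly the dimension that labelings require.\<close>

lemma ex_vec_encoding:
  assumes "finite V"
  shows "\<exists>enc :: ('v \<Rightarrow> real) \<Rightarrow> real vec. \<forall>f g. enc f \<in> carrier_vec (card V) \<and>
    scalar_prod (enc f) (enc g) = (\<Sum>v\<in>V. f v * g v)"
proof -
  obtain b where b: "bij_betw b {0..<card V} V"
    using assms ex_bij_betw_nat_finite by blast
  show ?thesis
    using sum.reindex_bij_betw[OF b, of "\<lambda>v. f v * g v" for f g :: "'v \<Rightarrow> real"]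
    by (intro exI[of _ "\<lambda>f. vec (card V) (\<lambda>i. f (b i))"]) (simp add: scalar_prod_def)
qed

text \<open>Giving each vertex its own coordinate vector is a labeling of any graph; so there are
  values to minimise over.\<close>

lemma ex_orthonormal_labeling:
  assumes "finite (pverts G)" "pverts G \<noteq> {}"
  shows "unit_vectors (card (pverts G)) \<noteq> {}" "orthonormal_labelings G \<noteq> {}"
proof -
  obtain enc :: "('a \<Rightarrow> real) \<Rightarrow> real vec" where
    enc: "\<And>f. enc f \<in> carrier_vec (card (pverts G))"
      "\<And>f g. scalar_prod (enc f) (enc g) = (\<Sum>v\<in>pverts G. f v * g v)"
    using ex_vec_encoding[OF assms(1)] by blast
  define \<psi> where "\<psi> v = enc (\<lambda>w. if w = v then 1 else 0)" for v
  have ip: "scalar_prod (\<psi> u) (\<psi> v) = (if u = v then 1 else 0)" if "v \<in> pverts G" for u v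
  proof -
    have "scalar_prod (\<psi> u) (\<psi> v) = (\<Sum>w\<in>pverts G. if w = v then if u = v then 1 else 0 else 0)"
      unfolding \<psi>_def enc(2) by (intro sum.cong refl) auto
    then show ?thesis using that assms(1) by simp
  qed
  have unit: "\<psi> v \<in> unit_vectors (card (pverts G))" if "v \<in> pverts G" for v
    using ip[OF that, of v] enc(1) by (simp add: unit_vectors_def \<psi>_def)
  then show "unit_vectors (card (pverts G)) \<noteq> {}" using assms(2) by blast
  have "\<psi> \<in> orthonormal_labelings G"
    using unit ip by (auto simp: orthonormal_labelings_def)
  then show "orthonormal_labelings G \<noteq> {}" by blast
qed

text \<open>Compactness: labelings with bounds tending to \<open>r\<close> have bounded coordinates,
  and a coordinatewise limit along a subsequence satisfies the bound \<open>r\<close>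
  itself.\<close>

lemma labeling_limit:
  fixes r :: real
  assumes fin: "finite (pverts G)" and ne: "pverts G \<noteq> {}"
    and p: "\<And>v. v \<in> pverts G \<Longrightarrow> 0 \<le> p v" and r: "0 \<le> r"
    and approx: "\<And>\<epsilon>. 0 < \<epsilon> \<Longrightarrow> \<exists>\<Psi>\<in>unit_vectors (card (pverts G)). \<exists>\<psi>\<in>orthonormal_labelings G.
      labeling_value G p \<Psi> \<psi> \<le> ereal (r + \<epsilon>)"
  shows "\<exists>\<Psi>\<in>unit_vectors (card (pverts G)). \<exists>\<psi>\<in>orthonormal_labelings G.
    labeling_value G p \<Psi> \<psi> \<le> ereal r"
proof -
  define V where "V = pverts G"
  define n where "n = card V"
  have "\<forall>k. \<exists>\<Psi> \<psi>. \<Psi> \<in> unit_vectors n \<and> \<psi> \<in> orthonormal_labelings G \<and>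
      labeling_value G p \<Psi> \<psi> \<le> ereal (r + 1 / Suc k)"
    using approx unfolding n_def V_def by (metis of_nat_0_less_iff zero_less_Suc zero_less_divide_1_iff)
  then obtain \<Psi>s \<psi>s where seq: "\<And>k. \<Psi>s k \<in> unit_vectors n"
      "\<And>k. \<psi>s k \<in> orthonormal_labelings G"
      "\<And>k. labeling_value G p (\<Psi>s k) (\<psi>s k) \<le> ereal (r + 1 / Suc k)"
    by metis
  \<comment> \<open>Handle and labels form one family, so that a single subsequence serves all of
    them; the handle sits at \<open>None\<close>.\<close>
  define X where "X k a = (case a of None \<Rightarrow> \<Psi>s k | Some v \<Rightarrow> \<psi>s k v)" for k a
  define A where "A = insert None (Some ` V)"
  have finA: "finite A" using fin by (simp add: A_def V_def)
  have X: "X k a \<in> unit_vectors n" if "a \<in> A" for k a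
    using that seq(1)[of k] orthonormal_labelings_unit[OF seq(2)[of k]]
    by (auto simp: X_def A_def V_def n_def)
  have "\<exists>\<sigma>. strict_mono (\<sigma> :: nat \<Rightarrow> nat) \<and>
      (\<forall>ai\<in>A \<times> {0..<n}. convergent (\<lambda>k. (\<lambda>(a, i). X (\<sigma> k) a $ i) ai))"
    by (rule finite_family_bolzano_weierstrass[where B = 1])
      (use finA unit_vectors_abs_le_1[OF X] in auto)
  then obtain \<sigma> :: "nat \<Rightarrow> nat" where \<sigma>: "strict_mono \<sigma>"
    "\<And>a i. a \<in> A \<Longrightarrow> i < n \<Longrightarrow> convergent (\<lambda>k. X (\<sigma> k) a $ i)"
    by fastforce
  define Y where "Y a = vec n (\<lambda>i. lim (\<lambda>k. X (\<sigma> k) a $ i))" for a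
  \<comment> \<open>Inner products converge, so unit length and orthogonality survive as limits of
    constant sequences.\<close>
  have ip: "(\<lambda>k. scalar_prod (X (\<sigma> k) a) (X (\<sigma> k) b)) \<longlonglongrightarrow> scalar_prod (Y a) (Y b)"
    if "a \<in> A" "b \<in> A" for a b
  proof -
    have "(\<lambda>k. \<Sum>i = 0..<n. X (\<sigma> k) a $ i * X (\<sigma> k) b $ i) \<longlonglongrightarrow> (\<Sum>i = 0..<n. Y a $ i * Y b $ i)"
      using \<sigma>(2) that
      by (auto simp: Y_def intro!: tendsto_sum tendsto_mult convergent_LIMSEQ_iff[THEN iffD1])
    moreover have "scalar_prod (Y a) (Y b) = (\<Sum>i = 0..<n. Y a $ i * Y b $ i)"
      by (simp add: Y_def scalar_prod_def)
    ultimately show ?thesis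
      by (simp add: scalar_prod_unit_vectors[OF X[OF that(2)]])
  qed
  have unit: "Y a \<in> unit_vectors n" if "a \<in> A" for a
  proof -
    have "(\<lambda>k. scalar_prod (X (\<sigma> k) a) (X (\<sigma> k) a)) = (\<lambda>_. 1)"
      using X[OF that] by (auto simp: unit_vectors_def)
    with ip[OF that that] have "scalar_prod (Y a) (Y a) = 1"
      by (simp add: LIMSEQ_const_iff)
    then show ?thesis by (simp add: unit_vectors_def Y_def)
  qed
  have "(\<lambda>v. Y (Some v)) \<in> orthonormal_labelings G"
    unfolding orthonormal_labelings_def
  proof (intro CollectI conjI ballI impI funcsetI)
    show "Y (Some v) \<in> unit_vectors (card (pverts G))" if "v \<in> pverts G" for v
      using unit[of "Some v"] that by (simp add: A_def V_def n_def)
    fix u v assume uv: "u \<in> pverts G" "v \<in> pverts G" "u \<noteq> v" "(u, v) \<notin> parcs G"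
    then have "(\<lambda>k. scalar_prod (X (\<sigma> k) (Some u)) (X (\<sigma> k) (Some v))) = (\<lambda>_. 0)"
      using orthonormal_labelings_orthogonal[OF seq(2)] by (simp add: X_def)
    with ip[of "Some u" "Some v"] uv show "scalar_prod (Y (Some u)) (Y (Some v)) = 0"
      by (simp add: LIMSEQ_const_iff A_def V_def)
  qed
  moreover have "Y None \<in> unit_vectors (card (pverts G))"
    using unit[of None] by (simp add: A_def V_def n_def)
  moreover have "p v \<le> r * (scalar_prod (Y None) (Y (Some v)))\<^sup>2" if v: "v \<in> pverts G" for v
  proof (rule LIMSEQ_le_const)
    have "(\<lambda>k. 1 / real (Suc (\<sigma> k))) \<longlonglongrightarrow> 0"
      using LIMSEQ_subseq_LIMSEQ[OF lim_1_over_n[THEN LIMSEQ_Suc] \<sigma>(1)] by (simp add: o_def)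
    then have "(\<lambda>k. (r + 1 / real (Suc (\<sigma> k))) * (scalar_prod (X (\<sigma> k) None) (X (\<sigma> k) (Some v)))\<^sup>2)
        \<longlonglongrightarrow> (r + 0) * (scalar_prod (Y None) (Y (Some v)))\<^sup>2"
      using v by (intro tendsto_intros ip) (auto simp: A_def V_def)
    then show "(\<lambda>k. (r + 1 / real (Suc (\<sigma> k))) * (scalar_prod (X (\<sigma> k) None) (X (\<sigma> k) (Some v)))\<^sup>2)
        \<longlonglongrightarrow> r * (scalar_prod (Y None) (Y (Some v)))\<^sup>2" by simp
    have "p v \<le> (r + 1 / real (Suc k)) * (scalar_prod (\<Psi>s k) (\<psi>s k v))\<^sup>2" for k
      using labeling_value_le_iff[where p = p and t = "r + 1 / Suc k", OF fin ne p] seq(3)[of k] r v by auto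
    then show "\<exists>N. \<forall>k\<ge>N. p v \<le>
        (r + 1 / real (Suc (\<sigma> k))) * (scalar_prod (X (\<sigma> k) None) (X (\<sigma> k) (Some v)))\<^sup>2"
      by (auto simp: X_def)
  qed
  ultimately show ?thesis
    using labeling_value_le_iff[where p = p and \<Psi> = "Y None" and \<psi> = "\<lambda>v. Y (Some v)", OF fin ne p r] by blast
qed

text \<open>\<open>LEAST\<close> is informative only if a least value exists, so the infimum of the
  values is shown to be one of them.\<close>

lemma weighted_lovasz_attained:
  assumes fin: "finite (pverts G)" and ne: "pverts G \<noteq> {}"
    and p: "\<And>v. v \<in> pverts G \<Longrightarrow> 0 \<le> p v"
  shows "\<exists>\<Psi>\<in>unit_vectors (card (pverts G)). \<exists>\<psi>\<in>orthonormal_labelings G.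
    weighted_lovasz G p = labeling_value G p \<Psi> \<psi>"
proof -
  define S where "S = {t. \<exists>\<Psi>\<in>unit_vectors (card (pverts G)). \<exists>\<psi>\<in>orthonormal_labelings G.
        t = labeling_value G p \<Psi> \<psi>}"
  obtain s where s: "s \<in> S"
    using ex_orthonormal_labeling[OF fin ne] by (auto simp: S_def)
  have pos: "0 \<le> Inf S"
    using labeling_value_nonneg[OF fin ne p] by (auto simp: S_def intro!: Inf_greatest)
  have min: "Inf S \<in> S"
  proof (cases "Inf S")
    case (real r)
    have r: "0 \<le> r" using pos real by simp
    have "\<exists>\<Psi>\<in>unit_vectors (card (pverts G)). \<exists>\<psi>\<in>orthonormal_labelings G.
      labeling_value G p \<Psi> \<psi> \<le> ereal (r + \<epsilon>)" if "0 < \<epsilon>" for \<epsilon>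
    proof -
      have "Inf S < ereal (r + \<epsilon>)" using real that by simp
      then obtain t where "t \<in> S" "t < ereal (r + \<epsilon>)" by (auto simp: Inf_less_iff)
      then show ?thesis by (auto simp: S_def intro: less_imp_le)
    qed
    then obtain \<Psi> \<psi> where "\<Psi> \<in> unit_vectors (card (pverts G))" "\<psi> \<in> orthonormal_labelings G"
        "labeling_value G p \<Psi> \<psi> \<le> Inf S"
      unfolding real using labeling_limit[where p = p, OF fin ne p r] by blast
    moreover from this have "labeling_value G p \<Psi> \<psi> \<in> S" by (auto simp: S_def)
    ultimately show ?thesis
      using antisym[OF _ Inf_lower, of "labeling_value G p \<Psi> \<psi>" S] by metis
  next
    case PInf
    \<comment> \<open>If the infimum is \<infinity>, so is every value, and any labeling attains
      it.\<close>
    have "Inf S \<le> s" using s by (rule Inf_lower)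
    then show ?thesis using PInf s by simp
  qed (use pos in simp)
  have "weighted_lovasz G p = (LEAST t. t \<in> S)"
    by (simp add: weighted_lovasz_def S_def)
  also have "\<dots> = Inf S"
    using min by (intro Least_equality Inf_lower) auto
  finally show ?thesis using min by (simp add: S_def)
qed

lemma weighted_lovasz_eqI:
  assumes "\<Psi> \<in> unit_vectors (card (pverts G))" "\<psi> \<in> orthonormal_labelings G"
    "labeling_value G p \<Psi> \<psi> = t"
    and "\<And>\<Psi> \<psi>. \<Psi> \<in> unit_vectors (card (pverts G)) \<Longrightarrow> \<psi> \<in> orthonormal_labelings G \<Longrightarrow>
      t \<le> labeling_value G p \<Psi> \<psi>"
  shows "weighted_lovasz G p = t"
  unfolding weighted_lovasz_def using assms by (intro Least_equality) blast+


section \<open>Labelings of value one\<close>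

text \<open>Pythagoras for the projection of \<open>\<Psi>\<close> onto the span of an orthonormal
  family. The identity serves twice: nonnegativity of the left side is Bessel's inequality, and its
  vanishing expands \<open>\<Psi>\<close> in the family.\<close>

lemma bessel_identity:
  fixes \<Psi> :: "'k \<Rightarrow> real"
  assumes "finite e" "\<And>u v. u \<in> e \<Longrightarrow> v \<in> e \<Longrightarrow> (\<Sum>k\<in>K. \<psi> u k * \<psi> v k) = (if u = v then 1 else 0)"
  defines "c \<equiv> \<lambda>v. \<Sum>k\<in>K. \<Psi> k * \<psi> v k"
  shows "(\<Sum>k\<in>K. (\<Psi> k - (\<Sum>v\<in>e. c v * \<psi> v k))\<^sup>2) = (\<Sum>k\<in>K. \<Psi> k * \<Psi> k) - (\<Sum>v\<in>e. (c v)\<^sup>2)"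
proof -
  have cross: "(\<Sum>k\<in>K. \<Psi> k * (\<Sum>v\<in>e. c v * \<psi> v k)) = (\<Sum>v\<in>e. (c v)\<^sup>2)"
  proof -
    have "(\<Sum>k\<in>K. \<Psi> k * (\<Sum>v\<in>e. c v * \<psi> v k)) = (\<Sum>v\<in>e. \<Sum>k\<in>K. c v * (\<Psi> k * \<psi> v k))"
      unfolding sum_distrib_left by (subst sum.swap) (simp add: algebra_simps)
    then show ?thesis by (simp add: sum_distrib_left[symmetric] c_def power2_eq_square)
  qed
  have "(\<Sum>k\<in>K. (\<Sum>v\<in>e. c v * \<psi> v k) * (\<Sum>v\<in>e. c v * \<psi> v k)) =
      (\<Sum>k\<in>K. \<Sum>u\<in>e. \<Sum>v\<in>e. c u * c v * (\<psi> u k * \<psi> v k))"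
    unfolding sum_product by (simp add: algebra_simps)
  also have "\<dots> = (\<Sum>u\<in>e. \<Sum>k\<in>K. \<Sum>v\<in>e. c u * c v * (\<psi> u k * \<psi> v k))"
    by (rule sum.swap)
  also have "\<dots> = (\<Sum>u\<in>e. \<Sum>v\<in>e. \<Sum>k\<in>K. c u * c v * (\<psi> u k * \<psi> v k))"
    by (intro sum.cong refl sum.swap)
  also have "\<dots> = (\<Sum>u\<in>e. \<Sum>v\<in>e. if u = v then (c u)\<^sup>2 else 0)"
    using assms(2) by (intro sum.cong refl) (simp add: sum_distrib_left[symmetric] power2_eq_square)
  also have "\<dots> = (\<Sum>v\<in>e. (c v)\<^sup>2)"
    using assms(1) by simp
  finally have square: "(\<Sum>k\<in>K. (\<Sum>v\<in>e. c v * \<psi> v k)\<^sup>2) = (\<Sum>v\<in>e. (c v)\<^sup>2)"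
    by (simp add: power2_eq_square)
  have "(\<Sum>k\<in>K. (\<Psi> k - (\<Sum>v\<in>e. c v * \<psi> v k))\<^sup>2) = (\<Sum>k\<in>K. \<Psi> k * \<Psi> k) +
      (\<Sum>k\<in>K. (\<Sum>v\<in>e. c v * \<psi> v k)\<^sup>2) - 2 * (\<Sum>k\<in>K. \<Psi> k * (\<Sum>v\<in>e. c v * \<psi> v k))"
    unfolding sum_distrib_left[of 2] sum.distrib[symmetric] sum_subtractf[symmetric]
    by (intro sum.cong refl) (simp add: power2_diff, simp add: power2_eq_square)
  then show ?thesis unfolding cross square by simp
qed

section \<open>Bessel's inequality on the edges of a scenario\<close>

context
  fixes H :: "'v hypergraph" and p :: "'v \<Rightarrow> real"
  assumes scenario: "contextuality_scenario H" and model: "p \<in> prob_models H"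
begin

private abbreviation (input) "G \<equiv> non_orthogonality_graph H"
private abbreviation (input) "V \<equiv> vertices H"

private lemma finite_vertices: "finite V" and vertices_nonempty: "V \<noteq> {}"
  using scenario by (auto simp: contextuality_scenario_def)

private lemma pverts_G [simp]: "pverts G = V"
  by (simp add: non_orthogonality_graph_def)

private lemma edge_subset: "e \<in> edges H \<Longrightarrow> e \<subseteq> V"
  using scenario by (auto simp: contextuality_scenario_def)

private lemma finite_edge: "e \<in> edges H \<Longrightarrow> finite e"
  using edge_subset finite_vertices finite_subset by blast

private lemma in_some_edge: "v \<in> V \<Longrightarrow> \<exists>e\<in>edges H. v \<in> e"
  using scenario unfolding contextuality_scenario_def by blast

private lemma p_nonneg: "v \<in> V \<Longrightarrow> 0 \<le> p v"
  using model by (auto simp: prob_models_def)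

private lemma p_edge: "e \<in> edges H \<Longrightarrow> (\<Sum>v\<in>e. p v) = 1"
  using model by (auto simp: prob_models_def)

private lemma edge_orthonormal:
  assumes "\<psi> \<in> orthonormal_labelings G" "e \<in> edges H" "u \<in> e" "v \<in> e"
  shows "(\<Sum>k = 0..<card V. \<psi> u $ k * \<psi> v $ k) = (if u = v then 1 else 0)"
proof -
  have uv: "u \<in> V" "v \<in> V" using assms edge_subset by auto
  have unit: "\<psi> v \<in> unit_vectors (card V)"
    using orthonormal_labelings_unit[OF assms(1)] uv by simp
  have "scalar_prod (\<psi> u) (\<psi> v) = (if u = v then 1 else 0)"
  proof (cases "u = v")
    case False
    then have "(u, v) \<notin> parcs G"
      using assms by (auto simp: non_orthogonality_graph_def orthogonal_def)
    then show ?thesis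
      using False orthonormal_labelings_orthogonal[OF assms(1)] uv by simp
  qed (use unit in \<open>simp add: unit_vectors_def\<close>)
  then show ?thesis by (simp add: scalar_prod_unit_vectors[OF unit])
qed

private lemma scalar_prod_label:
  assumes "\<psi> \<in> orthonormal_labelings G" "v \<in> V"
  shows "scalar_prod \<Psi> (\<psi> v) = (\<Sum>k = 0..<card V. \<Psi> $ k * \<psi> v $ k)"
  using orthonormal_labelings_unit[OF assms(1)] assms(2) by (intro scalar_prod_unit_vectors) simp

private lemma edge_bessel:
  assumes "\<Psi> \<in> unit_vectors (card V)" "\<psi> \<in> orthonormal_labelings G" "e \<in> edges H"
  shows "(\<Sum>k = 0..<card V. (\<Psi> $ k - (\<Sum>v\<in>e. scalar_prod \<Psi> (\<psi> v) * \<psi> v $ k))\<^sup>2) =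
    1 - (\<Sum>v\<in>e. (scalar_prod \<Psi> (\<psi> v))\<^sup>2)"
proof -
  have c: "scalar_prod \<Psi> (\<psi> v) = (\<Sum>k = 0..<card V. \<Psi> $ k * \<psi> v $ k)" if "v \<in> e" for v
    using that edge_subset assms by (intro scalar_prod_label) auto
  have "(\<Sum>k = 0..<card V. \<Psi> $ k * \<Psi> $ k) = 1"
    using assms(1) by (auto simp: unit_vectors_def scalar_prod_def)
  then show ?thesis
    using bessel_identity[OF finite_edge[OF assms(3)] edge_orthonormal[OF assms(2,3)], of "\<lambda>k. \<Psi> $ k"]
    by (simp add: c cong: sum.cong)
qed

private lemma edge_overlap_le_1:
  assumes "\<Psi> \<in> unit_vectors (card V)" "\<psi> \<in> orthonormal_labelings G" "e \<in> edges H"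
  shows "(\<Sum>v\<in>e. (scalar_prod \<Psi> (\<psi> v))\<^sup>2) \<le> 1"
proof -
  have "0 \<le> (\<Sum>k = 0..<card V. (\<Psi> $ k - (\<Sum>v\<in>e. scalar_prod \<Psi> (\<psi> v) * \<psi> v $ k))\<^sup>2)"
    by (intro sum_nonneg) simp
  then show ?thesis unfolding edge_bessel[OF assms] by simp
qed

private lemma value_le_iff:
  "0 \<le> t \<Longrightarrow> labeling_value G p \<Psi> \<psi> \<le> ereal t \<longleftrightarrow>
    (\<forall>v\<in>V. p v \<le> t * (scalar_prod \<Psi> (\<psi> v))\<^sup>2)"
  using labeling_value_le_iff[of G p t \<Psi> \<psi>] finite_vertices vertices_nonempty p_nonneg by simp

private lemma labeling_value_ge_1:
  assumes "\<Psi> \<in> unit_vectors (card V)" "\<psi> \<in> orthonormal_labelings G"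
  shows "1 \<le> labeling_value G p \<Psi> \<psi>"
proof -
  obtain e where e: "e \<in> edges H" using vertices_nonempty in_some_edge by blast
  have nonneg: "0 \<le> labeling_value G p \<Psi> \<psi>"
    using finite_vertices vertices_nonempty p_nonneg by (intro labeling_value_nonneg) auto
  show ?thesis
  proof (cases "labeling_value G p \<Psi> \<psi>")
    case (real t)
    have t: "0 \<le> t" using nonneg real by simp
    have "1 = (\<Sum>v\<in>e. p v)" using p_edge[OF e] by simp
    also have "\<dots> \<le> (\<Sum>v\<in>e. t * (scalar_prod \<Psi> (\<psi> v))\<^sup>2)"
      using value_le_iff[OF t, of \<Psi> \<psi>] real edge_subset[OF e] by (intro sum_mono) auto
    also have "\<dots> \<le> t * 1"
      unfolding sum_distrib_left[symmetric]
      using edge_overlap_le_1[OF assms e] t by (rule mult_left_mono)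
    finally show ?thesis using real by simp
  qed (use nonneg in auto)
qed

section \<open>From a labeling of value one to a matrix\<close>

private lemma value_1_imp_Q1:
  assumes \<Psi>: "\<Psi> \<in> unit_vectors (card V)" and \<psi>: "\<psi> \<in> orthonormal_labelings G"
    and val: "labeling_value G p \<Psi> \<psi> = 1"
  shows "p \<in> Q1 H"
proof -
  define n where "n = card V"
  define c where "c v = scalar_prod \<Psi> (\<psi> v)" for v
  have le: "p v \<le> (c v)\<^sup>2" if "v \<in> V" for v
    using value_le_iff[of 1 \<Psi> \<psi>] val that by (simp add: c_def one_ereal_def)
  have edge_sum: "(\<Sum>v\<in>e. (c v)\<^sup>2) = 1" if "e \<in> edges H" for e
  proof (rule antisym)
    show "(\<Sum>v\<in>e. (c v)\<^sup>2) \<le> 1" using edge_overlap_le_1[OF \<Psi> \<psi> that] by (simp add: c_def)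
    have "(\<Sum>v\<in>e. p v) \<le> (\<Sum>v\<in>e. (c v)\<^sup>2)"
      using le edge_subset[OF that] by (intro sum_mono) auto
    then show "1 \<le> (\<Sum>v\<in>e. (c v)\<^sup>2)" using p_edge[OF that] by simp
  qed
  \<comment> \<open>On an edge \<open>p\<close> lies below the squared overlaps and both sum to 1,
    so they agree termwise; every vertex lies in some edge.\<close>
  have p_eq: "p v = (c v)\<^sup>2" if v: "v \<in> V" for v
  proof -
    obtain e where e: "e \<in> edges H" "v \<in> e" using in_some_edge[OF v] by blast
    have "(\<Sum>v\<in>e. (c v)\<^sup>2 - p v) = 0"
      using edge_sum[OF e(1)] p_edge[OF e(1)] by (simp add: sum_subtractf)
    moreover have "\<forall>v\<in>e. 0 \<le> (c v)\<^sup>2 - p v"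
      using le edge_subset[OF e(1)] by auto
    ultimately have "(c v)\<^sup>2 - p v = 0"
      using e finite_edge[OF e(1)] sum_nonneg_eq_0_iff[of e "\<lambda>v. (c v)\<^sup>2 - p v"] by simp
    then show ?thesis by simp
  qed
  \<comment> \<open>This is the equality case of Bessel: the residual has norm zero.\<close>
  have expand: "\<Psi> $ k = (\<Sum>v\<in>e. c v * \<psi> v $ k)" if e: "e \<in> edges H" and k: "k < n" for e k
  proof -
    have "(\<Sum>k = 0..<n. (\<Psi> $ k - (\<Sum>v\<in>e. c v * \<psi> v $ k))\<^sup>2) = 0"
      using edge_bessel[OF \<Psi> \<psi> e] edge_sum[OF e] by (simp add: c_def n_def)
    then have "\<forall>k\<in>{0..<n}. (\<Psi> $ k - (\<Sum>v\<in>e. c v * \<psi> v $ k))\<^sup>2 = 0"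
      by (subst (asm) sum_nonneg_eq_0_iff) auto
    then show ?thesis using k by simp
  qed
  \<comment> \<open>A vertex gets the projection of the handle onto its label. Over an edge these
    projections add up to the handle, and their inner product with it is the squared
    overlap.\<close>
  define \<phi> where "\<phi> w k = (case w of None \<Rightarrow> \<Psi> $ k | Some v \<Rightarrow> c v * \<psi> v $ k)" for w k
  define M :: "'v option \<Rightarrow> 'v option \<Rightarrow> complex" where
    "M u w = of_real (\<Sum>k = 0..<n. \<phi> u k * \<phi> w k)" for u w
  have "psd_on (Q1_indices H) M"
    unfolding M_def by (rule psd_on_gram)
  moreover have "M None None = 1"
  proof -
    have "scalar_prod \<Psi> \<Psi> = 1" using \<Psi> by (simp add: unit_vectors_def)
    then show ?thesis
      unfolding M_def by (simp only: scalar_prod_unit_vectors[OF \<Psi>] \<phi>_def n_def option.case of_real_1)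
  qed
  moreover have "(\<Sum>x\<in>e. M (Some x) w) = M None w" if "e \<in> edges H" for e w
  proof -
    have "(\<Sum>x\<in>e. \<Sum>k = 0..<n. \<phi> (Some x) k * \<phi> w k) =
        (\<Sum>k = 0..<n. \<Sum>x\<in>e. \<phi> (Some x) k * \<phi> w k)"
      by (rule sum.swap)
    also have "\<dots> = (\<Sum>k = 0..<n. \<phi> None k * \<phi> w k)"
      using expand[OF that] by (intro sum.cong refl) (simp add: \<phi>_def sum_distrib_right[symmetric])
    finally show ?thesis unfolding M_def by (simp only: of_real_sum[symmetric])
  qed
  moreover have "M (Some u) (Some v) = 0" if uv: "orthogonal H u v" for u v
  proof -
    obtain e where e: "e \<in> edges H" "u \<in> e" "v \<in> e" "u \<noteq> v"
      using uv by (auto simp: orthogonal_def)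
    have "(\<Sum>k = 0..<n. \<phi> (Some u) k * \<phi> (Some v) k) =
        (\<Sum>k = 0..<n. c u * c v * (\<psi> u $ k * \<psi> v $ k))"
      by (intro sum.cong refl) (simp add: \<phi>_def algebra_simps)
    also have "\<dots> = c u * c v * (\<Sum>k = 0..<n. \<psi> u $ k * \<psi> v $ k)"
      by (simp add: sum_distrib_left)
    finally show ?thesis
      using edge_orthonormal[OF \<psi> e(1-3)] e(4) unfolding M_def by (simp del: of_real_sum add: n_def)
  qed
  moreover have "of_real (p v) = M (Some v) None" if v: "v \<in> V" for v
  proof -
    have "(\<Sum>k = 0..<n. \<phi> (Some v) k * \<phi> None k) = c v * (\<Sum>k = 0..<n. \<Psi> $ k * \<psi> v $ k)"
      by (simp add: \<phi>_def sum_distrib_left algebra_simps)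
    also have "\<dots> = p v"
      using p_eq[OF v] scalar_prod_label[OF \<psi> v, of \<Psi>]
      by (simp add: c_def n_def power2_eq_square)
    finally show ?thesis unfolding M_def by (simp only:)
  qed
  ultimately show ?thesis
    using model unfolding Q1_def prob_models_def by blast
qed

section \<open>From a matrix to a labeling of value one\<close>

private lemma Q1_imp_value_1:
  assumes "p \<in> Q1 H"
  shows "\<exists>\<Psi>\<in>unit_vectors (card V). \<exists>\<psi>\<in>orthonormal_labelings G. labeling_value G p \<Psi> \<psi> = 1"
proof -
  let ?I = "Q1_indices H"
  obtain M :: "'v option \<Rightarrow> 'v option \<Rightarrow> complex" where M: "psd_on ?I M" "M None None = 1"
    "\<And>e w. e \<in> edges H \<Longrightarrow> w \<in> ?I \<Longrightarrow> (\<Sum>x\<in>e. M (Some x) w) = M None w"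
    "\<And>u v. orthogonal H u v \<Longrightarrow> M (Some u) (Some v) = 0"
    "\<And>v. v \<in> V \<Longrightarrow> complex_of_real (p v) = M (Some v) None"
    using assms unfolding Q1_def by blast
  define R where "R u v = Re (M (Some u) (Some v))" for u v
  have finI: "finite ?I" using finite_vertices by (simp add: Q1_indices_def)
  have psdI: "real_psd_on ?I (\<lambda>i j. Re (M i j))"
    by (rule psd_on_imp_real_psd_on_Re[OF M(1) finI])
  have Re_None: "Re (M None (Some v)) = p v" if "v \<in> V" for v
  proof -
    have "Re (M None (Some v)) = Re (M (Some v) None)"
      using psdI that unfolding real_psd_on_def Q1_indices_def by blast
    then show ?thesis using M(5)[OF that] by (metis Re_complex_of_real)
  qed
  have R_edge: "(\<Sum>x\<in>e. R x v) = p v" if "e \<in> edges H" "v \<in> V" for e v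
  proof -
    have "(\<Sum>x\<in>e. R x v) = Re (\<Sum>x\<in>e. M (Some x) (Some v))" by (simp add: R_def)
    then show ?thesis using M(3)[OF that(1), of "Some v"] Re_None that by (simp add: Q1_indices_def)
  qed
  have R_orth: "R u v = 0" if "orthogonal H u v" for u v
    using M(4)[OF that] by (simp add: R_def)
  \<comment> \<open>The other vertices of an edge through \<open>v\<close> are orthogonal to
    \<open>v\<close>, so the edge sum collapses to the diagonal entry.\<close>
  have R_diag: "R v v = p v" if v: "v \<in> V" for v
  proof -
    obtain e where e: "e \<in> edges H" "v \<in> e" using in_some_edge[OF v] by blast
    have "(\<Sum>x\<in>e. R x v) = R v v + (\<Sum>x\<in>e - {v}. R x v)"
      using e finite_edge by (intro sum.remove) auto
    also have "(\<Sum>x\<in>e - {v}. R x v) = 0"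
      using e by (intro sum.neutral) (auto intro!: R_orth simp: orthogonal_def)
    finally show ?thesis using R_edge[OF e(1) v] by simp
  qed
  have R_zero: "R u v = 0" if "u \<in> V" "v \<in> V" "p u = 0" for u v
    using real_psd_on_zero_diag[OF psdI finI, of "Some u" "Some v"] R_diag[OF that(1)] that
    by (simp add: Q1_indices_def R_def)
  \<comment> \<open>On the support the Gram vectors have nonzero length and can be normalised; they
    use only coordinates in \<open>N\<close>, which leaves the others free.\<close>
  define N where "N = {v \<in> V. p v \<noteq> 0}"
  have N: "N \<subseteq> V" "finite N" using finite_vertices by (auto simp: N_def)
  have "real_psd_on (Some ` N) (\<lambda>i j. Re (M i j))"
    using N by (intro real_psd_on_subset[OF psdI finI]) (auto simp: Q1_indices_def)
  then obtain A where A: "\<And>u v. u \<in> N \<Longrightarrow> v \<in> N \<Longrightarrow>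
      R u v = (\<Sum>k\<in>N. A (Some u) (Some k) * A (Some v) (Some k))"
    using real_psd_on_gram[of "Some ` N" "\<lambda>i j. Re (M i j)"] N(2)
    by (auto simp: R_def sum.reindex)
  define \<phi> where "\<phi> v k = (if v \<in> N \<and> k \<in> N then A (Some v) (Some k) else 0)" for v k
  have \<phi>: "(\<Sum>k\<in>V. \<phi> u k * \<phi> v k) = R u v" if "u \<in> N" "v \<in> N" for u v
  proof -
    have "(\<Sum>k\<in>V. \<phi> u k * \<phi> v k) = (\<Sum>k\<in>N. \<phi> u k * \<phi> v k)"
      using N finite_vertices by (intro sum.mono_neutral_right) (auto simp: \<phi>_def)
    then show ?thesis using A[OF that] that by (simp add: \<phi>_def)
  qed
  obtain e where e: "e \<in> edges H" using vertices_nonempty in_some_edge by blast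
  \<comment> \<open>The index \<open>None\<close> is left out of the factorisation, since it would
    add a dimension. The handle is rebuilt as the sum of the vertex vectors over one edge.\<close>
  define \<omega> where "\<omega> k = (\<Sum>x\<in>e \<inter> N. \<phi> x k)" for k
  have \<omega>\<phi>: "(\<Sum>k\<in>V. \<omega> k * \<phi> v k) = p v" if v: "v \<in> N" for v
  proof -
    have "(\<Sum>k\<in>V. \<omega> k * \<phi> v k) = (\<Sum>x\<in>e \<inter> N. \<Sum>k\<in>V. \<phi> x k * \<phi> v k)"
      unfolding \<omega>_def sum_distrib_right by (rule sum.swap)
    also have "\<dots> = (\<Sum>x\<in>e \<inter> N. R x v)"
      using v by (intro sum.cong refl \<phi>) auto
    \<comment> \<open>Vertices outside the support have zero rows in \<open>R\<close>.\<close>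
    also have "\<dots> = (\<Sum>x\<in>e. R x v)"
      using finite_edge[OF e] edge_subset[OF e] v N
      by (intro sum.mono_neutral_left) (auto simp: N_def intro!: R_zero)
    finally show ?thesis using R_edge[OF e] v N by auto
  qed
  have \<omega>\<omega>: "(\<Sum>k\<in>V. \<omega> k * \<omega> k) = 1"
  proof -
    \<comment> \<open>Only one of the two factors is expanded, so that the overlaps just computed
      apply.\<close>
    have "(\<Sum>k\<in>V. \<omega> k * \<omega> k) = (\<Sum>k\<in>V. \<Sum>x\<in>e \<inter> N. \<omega> k * \<phi> x k)"
      by (subst (2) \<omega>_def) (simp add: sum_distrib_left)
    also have "\<dots> = (\<Sum>x\<in>e \<inter> N. \<Sum>k\<in>V. \<omega> k * \<phi> x k)" by (rule sum.swap)
    also have "\<dots> = (\<Sum>x\<in>e \<inter> N. p x)" using \<omega>\<phi> by simp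
    also have "\<dots> = (\<Sum>x\<in>e. p x)"
      using finite_edge[OF e] edge_subset[OF e]
      by (intro sum.mono_neutral_left) (auto simp: N_def)
    finally show ?thesis using p_edge[OF e] by simp
  qed
  \<comment> \<open>A coordinate vector at a vertex outside \<open>N\<close> is orthogonal to all
    other labels and to the handle, whose coordinates there vanish; its overlap is 0, as is
    \<open>p\<close> there.\<close>
  define \<chi> where
    "\<chi> v = (if v \<in> N then (\<lambda>k. \<phi> v k / sqrt (p v)) else (\<lambda>k. if k = v then 1 else 0))" for v
  obtain enc :: "('v \<Rightarrow> real) \<Rightarrow> real vec" where
    enc: "\<And>f. enc f \<in> carrier_vec (card V)"
      "\<And>f g. scalar_prod (enc f) (enc g) = (\<Sum>v\<in>V. f v * g v)"
    using ex_vec_encoding[OF finite_vertices] by blast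
  have pos: "0 < p v" if "v \<in> N" for v
    using that p_nonneg[of v] by (auto simp: N_def)
  have unit_\<chi>: "(\<Sum>k\<in>V. \<chi> v k * \<chi> v k) = 1" if v: "v \<in> V" for v
  proof (cases "v \<in> N")
    case True
    have "(\<Sum>k\<in>V. \<chi> v k * \<chi> v k) = (\<Sum>k\<in>V. \<phi> v k * \<phi> v k) / p v"
      using True pos[OF True] by (simp add: \<chi>_def sum_divide_distrib)
    then show ?thesis using \<phi>[OF True True] R_diag[OF v] pos[OF True] by simp
  next
    case False
    have "(\<Sum>k\<in>V. \<chi> v k * \<chi> v k) = (\<Sum>k\<in>V. if k = v then 1 else 0)"
      using False by (intro sum.cong) (auto simp: \<chi>_def)
    then show ?thesis using finite_vertices v by simp
  qed
  have orth_\<chi>: "(\<Sum>k\<in>V. \<chi> u k * \<chi> v k) = 0" if uv: "orthogonal H u v" for u v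
  proof (cases "u \<in> N \<and> v \<in> N")
    case True
    then have "(\<Sum>k\<in>V. \<chi> u k * \<chi> v k) = (\<Sum>k\<in>V. \<phi> u k * \<phi> v k) / (sqrt (p u) * sqrt (p v))"
      by (simp add: \<chi>_def sum_divide_distrib)
    then show ?thesis using \<phi> True R_orth[OF uv] by simp
  next
    case False
    have "u \<noteq> v" using uv by (simp add: orthogonal_def)
    then show ?thesis
      using False by (intro sum.neutral) (auto simp: \<chi>_def \<phi>_def)
  qed
  have overlap: "((\<Sum>k\<in>V. \<omega> k * \<chi> v k))\<^sup>2 = p v" if v: "v \<in> V" for v
  proof (cases "v \<in> N")
    case True
    have "(\<Sum>k\<in>V. \<omega> k * \<chi> v k) = (\<Sum>k\<in>V. \<omega> k * \<phi> v k) / sqrt (p v)"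
      using True by (simp add: \<chi>_def sum_divide_distrib)
    then show ?thesis
      using \<omega>\<phi>[OF True] pos[OF True] by (simp add: power_divide power2_eq_square)
  next
    case False
    have "(\<Sum>k\<in>V. \<omega> k * \<chi> v k) = 0"
      using False by (intro sum.neutral) (auto simp: \<chi>_def \<omega>_def \<phi>_def)
    then show ?thesis using False v by (simp add: N_def)
  qed
  have unit: "enc \<omega> \<in> unit_vectors (card V)"
    using enc \<omega>\<omega> by (simp add: unit_vectors_def)
  have lab: "(\<lambda>v. enc (\<chi> v)) \<in> orthonormal_labelings G"
    using enc unit_\<chi> orth_\<chi>
    by (auto simp: orthonormal_labelings_def unit_vectors_def non_orthogonality_graph_def)
  \<comment> \<open>The upper bound suffices, since no labeling has value below 1.\<close>
  have "labeling_value G p (enc \<omega>) (\<lambda>v. enc (\<chi> v)) \<le> ereal 1"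
    by (subst value_le_iff) (simp_all add: enc(2) overlap)
  then have "labeling_value G p (enc \<omega>) (\<lambda>v. enc (\<chi> v)) = 1"
    using labeling_value_ge_1[OF unit lab] by (simp add: one_ereal_def)
  then show ?thesis using unit lab by blast
qed

lemma Q1_iff_weighted_lovasz_eq_1:
  "p \<in> Q1 H \<longleftrightarrow> weighted_lovasz (non_orthogonality_graph H) p = 1"
proof
  assume "p \<in> Q1 H"
  then obtain \<Psi> \<psi> where "\<Psi> \<in> unit_vectors (card V)" "\<psi> \<in> orthonormal_labelings G"
      "labeling_value G p \<Psi> \<psi> = 1"
    using Q1_imp_value_1 by blast
  then show "weighted_lovasz G p = 1"
    using labeling_value_ge_1 by (intro weighted_lovasz_eqI) auto
next
  assume "weighted_lovasz G p = 1"
  \<comment> \<open>Attainment turns the value of the minimum into an actual labeling of value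
    1.\<close>
  then show "p \<in> Q1 H"
    using weighted_lovasz_attained[of G p] finite_vertices vertices_nonempty p_nonneg value_1_imp_Q1
    by auto
qed

end

theorem proposition6p3p2:
  fixes H :: "'v hypergraph" and p :: "'v \<Rightarrow> real"
  assumes "contextuality_scenario H"
    and "p \<in> prob_models H"
  shows "p \<in> Q1 H \<longleftrightarrow> weighted_lovasz (non_orthogonality_graph H) p = 1"
  using assms by (rule Q1_iff_weighted_lovasz_eq_1)

end
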